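(* Fix distinct points $A,B$ in the Euclidean plane. For $C$ not on line $AB$, let $a=|BC|$, $b=|CA|$, $c=|AB|$, and let $\mathcal{Y}$ be the conic through the six vertices of the V-ellipses of $\triangle ABC$. Then: (i) $\mathcal{Y}$ is degenerate if $C$ lies on the union of the circle with diameter $AB$ and the two lines tangent to that circle at $A$ and at $B$; (ii) $\mathcal{Y}$ is a parabola if $C$ lies on the curve given by the degree-8 equation $$a^8+b^8+c^8-2(a^4b^4+a^4c^4+b^4c^4)+4abc\left(a^5+b^5+c^5-a^4b-ab^4-a^4c-ac^4-bc^4-b^4c+a^3bc+ab^3c+abc^3\right)=0.$$
   Context: Given a triangle $\triangle ABC$, the V-ellipse $\mathcal{E}_a$ is the ellipse with foci $B,C$ passing through $A$; $\mathcal{E}_b$ is the ellipse with foci $C,A$ passing through $B$; $\mathcal{E}_c$ is the ellipse with foci $A,B$ passing through $C$. The vertices of an ellipse are its two intersections with its focal axis (the line through the foci). The six vertices of the three V-ellipses always lie on a conic $\mathcal{Y}$ (the Yiu conic). A conic is degenerate if the $3\times 3$ symmetric matrix of its homogeneous equation is singular. *)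

theory Defs
  imports "HOL-Analysis.Analysis"
begin

definition v_ellipse :: "real^2 \<Rightarrow> real^2 \<Rightarrow> real^2 \<Rightarrow> (real^2) set" where
  "v_ellipse F1 F2 X = {P. dist P F1 + dist P F2 = dist X F1 + dist X F2}"

definition v_ellipse_vertices :: "real^2 \<Rightarrow> real^2 \<Rightarrow> real^2 \<Rightarrow> (real^2) set" where
  "v_ellipse_vertices F1 F2 X = v_ellipse F1 F2 X \<inter> affine hull {F1, F2}"

definition six_vertices :: "real^2 \<Rightarrow> real^2 \<Rightarrow> real^2 \<Rightarrow> (real^2) set" where
  "six_vertices A B C =
     v_ellipse_vertices B C A \<union> v_ellipse_vertices C A B \<union> v_ellipse_vertices A B C"

definition hom_coords :: "real^2 \<Rightarrow> real^3" where
  "hom_coords P = vector [P $ 1, P $ 2, 1]"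

text \<open>A conic is represented by the symmetric matrix of its homogeneous equation, which it
  determines up to a nonzero factor.  The definition admits degenerate conics.\<close>

definition is_conic :: "real^3^3 \<Rightarrow> bool" where
  "is_conic M \<longleftrightarrow> transpose M = M \<and> M \<noteq> 0"

definition conic_points :: "real^3^3 \<Rightarrow> (real^2) set" where
  "conic_points M = {P. hom_coords P \<bullet> (M *v hom_coords P) = 0}"

definition degenerate_conic :: "real^3^3 \<Rightarrow> bool" where
  "degenerate_conic M \<longleftrightarrow> det M = 0"

definition is_parabola :: "(real^2) set \<Rightarrow> bool" where
  "is_parabola S \<longleftrightarrow>
     (\<exists>F U V. U \<noteq> V \<and> F \<notin> affine hull {U, V} \<and>
        S = {P. dist P F = infdist P (affine hull {U, V})})"

text \<open>For a noncollinear triple such a matrix exists and is unique up to a nonzero factor: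
  see \<open>yiu_conic_exists\<close> and \<open>yiu_conic_unique\<close> below.\<close>

definition is_yiu_conic :: "real^2 \<Rightarrow> real^2 \<Rightarrow> real^2 \<Rightarrow> real^3^3 \<Rightarrow> bool" where
  "is_yiu_conic A B C M \<longleftrightarrow> is_conic M \<and> six_vertices A B C \<subseteq> conic_points M"

definition diameter_circle :: "real^2 \<Rightarrow> real^2 \<Rightarrow> (real^2) set" where
  "diameter_circle A B = sphere (midpoint A B) (dist A B / 2)"

text \<open>The tangent at \<open>T\<close> to the circle through \<open>T\<close> with centre \<open>Z\<close>, where \<open>T \<noteq> Z\<close>.\<close>

definition circle_tangent :: "real^2 \<Rightarrow> real^2 \<Rightarrow> (real^2) set" where
  "circle_tangent Z T = {P. (P - T) \<bullet> (T - Z) = 0}"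

lemma circle_tangent_Int_sphere:
  assumes "T \<in> sphere Z r" shows "circle_tangent Z T \<inter> sphere Z r = {T}"
proof -
  have "P = T" if P: "P \<in> circle_tangent Z T" "P \<in> sphere Z r" for P
  proof -
    have "orthogonal (P - T) (T - Z)"
      using P(1) by (simp add: circle_tangent_def orthogonal_def)
    from norm_add_Pythagorean[OF this]
    have "(norm (P - Z))\<^sup>2 = (norm (P - T))\<^sup>2 + (norm (T - Z))\<^sup>2" by simp
    moreover have "norm (P - Z) = norm (T - Z)"
      using P(2) assms by (simp add: dist_norm norm_minus_commute)
    ultimately show ?thesis by simp
  qed
  with assms show ?thesis by (auto simp: circle_tangent_def)
qed

definition conic_form :: "real^3^3 \<Rightarrow> real^2 \<Rightarrow> real^2 \<Rightarrow> real" where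
  "conic_form M P Q = hom_coords P \<bullet> (M *v hom_coords Q)"

lemma conic_form_sym:
  assumes "transpose M = M" shows "conic_form M P Q = conic_form M Q P"
  unfolding conic_form_def
  by (metis assms dot_lmul_matrix inner_commute vector_transpose_matrix)

lemma hom_coords_line:
  "hom_coords (P + t *\<^sub>R (Q - P)) = (1 - t) *\<^sub>R hom_coords P + t *\<^sub>R hom_coords Q"
  by (simp add: hom_coords_def vec_eq_iff forall_3 vector_3 algebra_simps)

lemma conic_form_line:
  assumes "transpose M = M"
  shows "conic_form M (P + t *\<^sub>R (Q - P)) (P + t *\<^sub>R (Q - P)) =
    (1 - t)\<^sup>2 * conic_form M P P + 2 * t * (1 - t) * conic_form M P Q + t\<^sup>2 * conic_form M Q Q"
proof -
  have "hom_coords Q \<bullet> (M *v hom_coords P) = hom_coords P \<bullet> (M *v hom_coords Q)"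
    using conic_form_sym[OF assms] by (simp add: conic_form_def)
  then show ?thesis
    unfolding conic_form_def hom_coords_line
    by (simp add: matrix_vector_right_distrib matrix_vector_mult_scaleR
        inner_add_left inner_add_right) (simp add: power2_eq_square ring_distribs)
qed

lemma vertices_on_conic_iff:
  fixes F1 F2 X :: "real^2"
  defines "a \<equiv> dist F1 F2" and "d \<equiv> dist X F1 + dist X F2"
  assumes ne: "F1 \<noteq> F2" and da: "d > a" and sym: "transpose M = M"
  shows "v_ellipse_vertices F1 F2 X \<subseteq> conic_points M \<longleftrightarrow>
    conic_form M F2 F2 = conic_form M F1 F1 \<and>
    conic_form M F1 F2 = (1 + 2 * a\<^sup>2 / (d\<^sup>2 - a\<^sup>2)) * conic_form M F1 F1"
proof -
  let ?P = "\<lambda>t. F1 + t *\<^sub>R (F2 - F1)"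
  define g h p where "g = conic_form M F1 F1" and "h = conic_form M F2 F2"
    and "p = conic_form M F1 F2"
  have a0: "a > 0" using ne by (simp add: a_def)
  have d1: "dist (?P t) F1 = \<bar>t\<bar> * a" for t
    by (simp add: a_def dist_norm norm_minus_commute)
  have d2: "dist (?P t) F2 = \<bar>1 - t\<bar> * a" for t
  proof -
    have "?P t - F2 = (1 - t) *\<^sub>R (F1 - F2)" by (simp add: algebra_simps)
    then show ?thesis by (simp add: a_def dist_norm)
  qed
  have on: "?P t \<in> conic_points M \<longleftrightarrow> (1 - t)\<^sup>2 * g + 2 * t * (1 - t) * p + t\<^sup>2 * h = 0" for t
    using conic_form_line[OF sym, of F1 t F2]
    by (simp add: conic_points_def conic_form_def[symmetric] g_def h_def p_def)
  have vert: "?P t \<in> v_ellipse F1 F2 X \<longleftrightarrow> t = (a + d) / (2 * a) \<or> t = (a - d) / (2 * a)" for t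
  proof -
    have "?P t \<in> v_ellipse F1 F2 X \<longleftrightarrow> \<bar>t\<bar> * a + \<bar>1 - t\<bar> * a = d"
      by (simp add: v_ellipse_def d1 d2 d_def)
    also have "\<dots> \<longleftrightarrow> \<bar>t * a\<bar> + \<bar>a - t * a\<bar> = d"
    proof -
      have "\<bar>t * a\<bar> = \<bar>t\<bar> * a" "\<bar>a - t * a\<bar> = \<bar>1 - t\<bar> * a"
        using a0 abs_mult[of t a] abs_mult[of "1 - t" a] by (simp_all add: left_diff_distrib)
      then show ?thesis by simp
    qed
    also have "\<dots> \<longleftrightarrow> 2 * (t * a) = a + d \<or> 2 * (t * a) = a - d"
      using a0 da by linarith
    also have "\<dots> \<longleftrightarrow> t = (a + d) / (2 * a) \<or> t = (a - d) / (2 * a)"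
      using a0 by (simp add: field_simps)
    finally show ?thesis .
  qed
  let ?t = "(a + d) / (2 * a)" and ?t' = "(a - d) / (2 * a)"
  have "v_ellipse_vertices F1 F2 X = {?P ?t, ?P ?t'}"
    unfolding v_ellipse_vertices_def affine_hull_2_alt using vert by auto
  then have "v_ellipse_vertices F1 F2 X \<subseteq> conic_points M \<longleftrightarrow>
      (1 - ?t)\<^sup>2 * g + 2 * ?t * (1 - ?t) * p + ?t\<^sup>2 * h = 0 \<and>
      (1 - ?t')\<^sup>2 * g + 2 * ?t' * (1 - ?t') * p + ?t'\<^sup>2 * h = 0"
    by (simp add: on)
  also have "\<dots> \<longleftrightarrow>
      (a - d)\<^sup>2 * g + 2 * (a + d) * (a - d) * p + (a + d)\<^sup>2 * h = 0 \<and>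
      (a + d)\<^sup>2 * g + 2 * (a - d) * (a + d) * p + (a - d)\<^sup>2 * h = 0"
  proof -
    have t: "1 - ?t = (a - d) / (2 * a)" "1 - ?t' = (a + d) / (2 * a)"
      using a0 by (simp_all add: field_simps)
    have e: "(x / (2*a))\<^sup>2 * g + 2 * (y / (2*a)) * (x / (2*a)) * p + (y / (2*a))\<^sup>2 * h =
       (x\<^sup>2 * g + 2 * y * x * p + y\<^sup>2 * h) / (2*a)\<^sup>2" for x y
      using a0 by (simp add: power2_eq_square field_simps)
    show ?thesis unfolding t e using a0 by simp
  qed
  also have "\<dots> \<longleftrightarrow> h = g \<and> (d\<^sup>2 - a\<^sup>2) * p = (a\<^sup>2 + d\<^sup>2) * g"
  proof
    assume L: "(a - d)\<^sup>2 * g + 2 * (a + d) * (a - d) * p + (a + d)\<^sup>2 * h = 0 \<and>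
      (a + d)\<^sup>2 * g + 2 * (a - d) * (a + d) * p + (a - d)\<^sup>2 * h = 0"
    then have "4 * a * d * (h - g) = 0" by algebra
    moreover have "4 * a * d \<noteq> 0" using a0 da by simp
    ultimately have hg: "h = g" by simp
    show "h = g \<and> (d\<^sup>2 - a\<^sup>2) * p = (a\<^sup>2 + d\<^sup>2) * g"
      using L unfolding hg by (auto simp: power2_eq_square algebra_simps)
  next
    assume R: "h = g \<and> (d\<^sup>2 - a\<^sup>2) * p = (a\<^sup>2 + d\<^sup>2) * g"
    then have hg: "h = g" and q: "(d\<^sup>2 - a\<^sup>2) * p = (a\<^sup>2 + d\<^sup>2) * g" by auto
    show "(a - d)\<^sup>2 * g + 2 * (a + d) * (a - d) * p + (a + d)\<^sup>2 * h = 0 \<and>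
      (a + d)\<^sup>2 * g + 2 * (a - d) * (a + d) * p + (a - d)\<^sup>2 * h = 0"
      unfolding hg using q by (simp add: power2_eq_square algebra_simps)
  qed
  also have "\<dots> \<longleftrightarrow> h = g \<and> p = (1 + 2 * a\<^sup>2 / (d\<^sup>2 - a\<^sup>2)) * g"
  proof -
    have nz: "d\<^sup>2 - a\<^sup>2 \<noteq> 0" using a0 da by (simp add: power2_eq_iff)
    then have "1 + 2 * a\<^sup>2 / (d\<^sup>2 - a\<^sup>2) = (a\<^sup>2 + d\<^sup>2) / (d\<^sup>2 - a\<^sup>2)"
      by (simp add: field_simps)
    with nz show ?thesis by (auto simp: field_simps)
  qed
  finally show ?thesis by (simp add: g_def h_def p_def)
qed

lemma foci_sum_gt:
  fixes F1 F2 X :: "real^2"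
  assumes "X \<notin> affine hull {F1, F2}"
  shows "dist X F1 + dist X F2 > dist F1 F2"
proof (rule ccontr)
  assume "\<not> ?thesis"
  then have "dist F1 F2 = dist F1 X + dist X F2"
    using dist_triangle[of F1 F2 X] by (simp add: dist_commute)
  then have "between (F1, F2) X" by (simp add: between)
  then have "X \<in> convex hull {F1, F2}"
    by (simp add: between_mem_segment segment_convex_hull)
  with assms show False using convex_hull_subset_affine_hull by blast
qed

lemma noncollinear_perm:
  fixes A B C :: "real^2"
  assumes "A \<noteq> B" "C \<notin> affine hull {A, B}"
  shows "B \<noteq> C" "C \<noteq> A" "A \<notin> affine hull {B, C}" "B \<notin> affine hull {C, A}"
proof -
  have nc: "\<not> collinear {A, B, C}"
    using assms by (simp add: collinear_3_affine_hull)
  show "B \<noteq> C" "C \<noteq> A" using assms(2) by (auto simp: hull_inc)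
  have p: "{B, C, A} = {A, B, C}" "{C, A, B} = {A, B, C}" by auto
  show "A \<notin> affine hull {B, C}"
    using collinear_3_affine_hull[OF \<open>B \<noteq> C\<close>, of A] nc p by simp
  show "B \<notin> affine hull {C, A}"
    using collinear_3_affine_hull[OF \<open>C \<noteq> A\<close>, of B] nc p by simp
qed

definition frame :: "real^2 \<Rightarrow> real^2 \<Rightarrow> real^2 \<Rightarrow> real^3^3" where
  "frame A B C = transpose (vector [hom_coords A, hom_coords B, hom_coords C])"

lemma frame_axis:
  "frame A B C *v axis 1 1 = hom_coords A"
  "frame A B C *v axis 2 1 = hom_coords B"
  "frame A B C *v axis 3 1 = hom_coords C"
  by (simp_all add: frame_def matrix_vector_mult_basis column_transpose row_def
      vec_eq_iff vector_3)

lemma invertible_frame: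
  assumes ne: "A \<noteq> B" and nc: "C \<notin> affine hull {A, B}"
  shows "invertible (frame A B C)"
proof -
  have "det (frame A B C) \<noteq> 0"
  proof
    assume "det (frame A B C) = 0"
    then have z: "(B$1 - A$1) * (C$2 - A$2) = (B$2 - A$2) * (C$1 - A$1)"
      unfolding frame_def det_transpose
      by (simp add: det_3 hom_coords_def vector_3) (simp add: algebra_simps)
    have "\<exists>t. C = A + t *\<^sub>R (B - A)"
    proof (cases "B$1 = A$1")
      case True
      then have "B$2 \<noteq> A$2" using ne by (auto simp: vec_eq_iff forall_2)
      with z True have "C = A + ((C$2 - A$2) / (B$2 - A$2)) *\<^sub>R (B - A)"
        by (auto simp: vec_eq_iff forall_2)
      then show ?thesis by blast
    next
      case False
      then have "(C$1 - A$1) * (B$2 - A$2) / (B$1 - A$1) = C$2 - A$2"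
        using z by (simp add: divide_eq_eq mult.commute)
      with False have "C = A + ((C$1 - A$1) / (B$1 - A$1)) *\<^sub>R (B - A)"
        by (simp add: vec_eq_iff forall_2)
      then show ?thesis by blast
    qed
    with nc show False by (auto simp: affine_hull_2_alt)
  qed
  then show ?thesis by (simp add: invertible_det_nz)
qed

lemma entry_as_form: "(N :: real^3^3) $ i $ j = axis i 1 \<bullet> (N *v axis j 1)"
  by (simp add: matrix_vector_mult_basis column_def inner_axis')

lemma congruence_form:
  fixes T M :: "real^3^3"
  shows "x \<bullet> ((transpose T ** M ** T) *v y) = (T *v x) \<bullet> (M *v (T *v y))"
  by (metis dot_lmul_matrix matrix_vector_mul_assoc vector_transpose_matrix
      transpose_transpose)

lemma matrix_eqI_on_frame:
  assumes "A \<noteq> B" "C \<notin> affine hull {A, B}"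
    and sym: "transpose M = M" "transpose N = N"
    and "conic_form M A A = conic_form N A A" "conic_form M B B = conic_form N B B"
      "conic_form M C C = conic_form N C C" "conic_form M B C = conic_form N B C"
      "conic_form M C A = conic_form N C A" "conic_form M A B = conic_form N A B"
  shows "M = N"
proof -
  define T where "T = frame A B C"
  note sy = conic_form_sym[OF sym(1)] conic_form_sym[OF sym(2)]
  have "(transpose T ** M ** T) $ i $ j = (transpose T ** N ** T) $ i $ j" for i j
    using exhaust_3[of i] exhaust_3[of j] assms sy
    by (auto simp: entry_as_form congruence_form T_def frame_axis conic_form_def)
  then have eq: "transpose T ** M ** T = transpose T ** N ** T" by (simp add: vec_eq_iff)
  from invertible_frame[OF assms(1,2)] obtain S where S: "T ** S = mat 1"
    unfolding T_def invertible_def by blast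
  then have S': "transpose S ** transpose T = mat 1"
    by (metis matrix_transpose_mul transpose_mat)
  have "transpose S ** (transpose T ** X ** T) ** S = X" for X :: "real^3^3"
  proof -
    have "transpose S ** (transpose T ** X ** T) ** S =
        (transpose S ** transpose T) ** X ** (T ** S)"
      by (simp add: matrix_mul_assoc)
    then show ?thesis by (simp add: S S')
  qed
  with eq show ?thesis by metis
qed

lemma is_yiu_conic_iff:
  assumes ne: "A \<noteq> B" and nc: "C \<notin> affine hull {A, B}"
  shows "\<exists>u v w. \<forall>M. is_yiu_conic A B C M \<longleftrightarrow> is_conic M \<and>
     conic_form M B B = conic_form M A A \<and> conic_form M C C = conic_form M A A \<and>
     conic_form M B C = u * conic_form M A A \<and> conic_form M C A = v * conic_form M A A \<and>
     conic_form M A B = w * conic_form M A A"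
proof -
  note p = noncollinear_perm[OF ne nc]
  define k where "k F1 F2 X = 1 + 2 * (dist F1 F2)\<^sup>2 /
    ((dist X F1 + dist X F2)\<^sup>2 - (dist F1 F2)\<^sup>2)" for F1 F2 X :: "real^2"
  have "is_yiu_conic A B C M \<longleftrightarrow> is_conic M \<and>
     conic_form M B B = conic_form M A A \<and> conic_form M C C = conic_form M A A \<and>
     conic_form M B C = k B C A * conic_form M A A \<and>
     conic_form M C A = k C A B * conic_form M A A \<and>
     conic_form M A B = k A B C * conic_form M A A" for M
  proof (cases "transpose M = M")
    case True
    note i = vertices_on_conic_iff[OF _ _ True, folded k_def]
    have "is_yiu_conic A B C M \<longleftrightarrow> is_conic M \<and>
        (conic_form M C C = conic_form M B B \<and>
         conic_form M B C = k B C A * conic_form M B B) \<and>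
        (conic_form M A A = conic_form M C C \<and>
         conic_form M C A = k C A B * conic_form M C C) \<and>
        (conic_form M B B = conic_form M A A \<and>
         conic_form M A B = k A B C * conic_form M A A)"
      unfolding is_yiu_conic_def six_vertices_def Un_subset_iff
        i[OF p(1) foci_sum_gt[OF p(3)]] i[OF p(2) foci_sum_gt[OF p(4)]]
        i[OF ne foci_sum_gt[OF nc]]
      by blast
    then show ?thesis by metis
  qed (simp add: is_yiu_conic_def is_conic_def)
  then show ?thesis by blast
qed

theorem yiu_conic_exists:
  assumes ne: "A \<noteq> B" and nc: "C \<notin> affine hull {A, B}"
  shows "\<exists>M. is_yiu_conic A B C M"
proof -
  obtain u v w where iff: "\<And>M. is_yiu_conic A B C M \<longleftrightarrow> is_conic M \<and>
     conic_form M B B = conic_form M A A \<and> conic_form M C C = conic_form M A A \<and>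
     conic_form M B C = u * conic_form M A A \<and> conic_form M C A = v * conic_form M A A \<and>
     conic_form M A B = w * conic_form M A A"
    using is_yiu_conic_iff[OF ne nc] by blast
  define T where "T = frame A B C"
  define K :: "real^3^3" where
    "K = vector [vector [1, w, v], vector [w, 1, u], vector [v, u, 1]]"
  from invertible_frame[OF ne nc] obtain S where S: "S ** T = mat 1"
    unfolding T_def invertible_def by blast
  define M where "M = transpose S ** K ** S"
  have st: "S *v hom_coords A = axis 1 1" "S *v hom_coords B = axis 2 1"
      "S *v hom_coords C = axis 3 1"
    unfolding frame_axis[of A B C, symmetric] T_def[symmetric]
    by (simp_all add: matrix_vector_mul_assoc S)
  have "transpose K = K"
    by (simp add: K_def transpose_def vec_eq_iff forall_3 vector_3)
  then have sym: "transpose M = M"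
    by (simp add: M_def matrix_transpose_mul matrix_mul_assoc)
  have f: "conic_form M A A = 1" "conic_form M B B = 1" "conic_form M C C = 1"
     "conic_form M B C = u" "conic_form M C A = v" "conic_form M A B = w"
    by (simp_all add: conic_form_def M_def congruence_form st entry_as_form[symmetric]
        K_def vector_3)
  have "M \<noteq> 0" using f(1) by (auto simp: conic_form_def)
  with sym f have "is_yiu_conic A B C M" by (simp add: iff is_conic_def)
  then show ?thesis ..
qed

theorem yiu_conic_unique:
  assumes ne: "A \<noteq> B" and nc: "C \<notin> affine hull {A, B}"
    and M: "is_yiu_conic A B C M" and N: "is_yiu_conic A B C N"
  shows "\<exists>k. k \<noteq> 0 \<and> N = k *\<^sub>R M"
proof -
  obtain u v w where iff: "\<And>M. is_yiu_conic A B C M \<longleftrightarrow> is_conic M \<and>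
     conic_form M B B = conic_form M A A \<and> conic_form M C C = conic_form M A A \<and>
     conic_form M B C = u * conic_form M A A \<and> conic_form M C A = v * conic_form M A A \<and>
     conic_form M A B = w * conic_form M A A"
    using is_yiu_conic_iff[OF ne nc] by blast
  have sc: "conic_form (k *\<^sub>R X) P Q = k * conic_form X P Q" for k X P Q
    by (simp add: conic_form_def scaleR_matrix_vector_assoc[symmetric])
  have z: "conic_form 0 P Q = 0" for P Q
    by (simp add: conic_form_def)
  have nz: "conic_form X A A \<noteq> 0" if X: "is_yiu_conic A B C X" for X
  proof
    assume 0: "conic_form X A A = 0"
    have t0: "transpose (0 :: real^3^3) = 0" by (simp add: transpose_def vec_eq_iff)
    note f = X[unfolded iff]
    have "X = 0"
      by (rule matrix_eqI_on_frame[OF ne nc _ t0])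
        (use f in \<open>simp_all only: is_conic_def z 0 mult_zero_right\<close>)
    with f show False by (simp add: is_conic_def)
  qed
  define k where "k = conic_form N A A / conic_form M A A"
  have kA: "k * conic_form M A A = conic_form N A A" using nz[OF M] by (simp add: k_def)
  have k: "k * (x * conic_form M A A) = x * conic_form N A A" for x
    using kA by (metis mult.left_commute)
  note fM = M[unfolded iff] and fN = N[unfolded iff]
  have tN: "transpose N = N" and tM: "transpose M = M"
    using fM fN by (simp_all add: is_conic_def)
  have tk: "transpose (k *\<^sub>R M) = k *\<^sub>R M"
    using tM by (simp add: transpose_def vec_eq_iff)
  have "N = k *\<^sub>R M"
    by (rule matrix_eqI_on_frame[OF ne nc tN tk]) (use fM fN in \<open>simp_all only: sc kA k\<close>)
  moreover have "k \<noteq> 0" using nz[OF M] nz[OF N] by (simp add: k_def)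
  ultimately show ?thesis by blast
qed

end

theory Submission
  imports Defs
begin

text \<open>In barycentric coordinates with respect to \<open>A, B, C\<close> the conic has, after scaling, the Gram
  matrix with unit diagonal and off-diagonal entries \<open>1 + U\<close>, \<open>1 + V\<close>, \<open>1 + W\<close>, where
  \<open>U = 2a\<^sup>2 / ((b + c)\<^sup>2 - a\<^sup>2)\<close> and cyclically.  With
  \<open>\<Delta> = 2(UV + VW + WU) - U\<^sup>2 - V\<^sup>2 - W\<^sup>2\<close>, its determinant is \<open>\<Delta> + 2UVW\<close>, and the discriminant
  of its quadratic part is \<open>\<Delta>\<close>, up to nonzero factors.  A right angle makes the determinant vanish.
  The octic is \<open>\<Delta>\<close> with denominators cleared; when it vanishes, the determinant is
  \<open>2UVW \<noteq> 0\<close>, so the conic is a nondegenerate parabola.\<close>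

section \<open>Determinant and discriminant from the values of the form at a triangle\<close>

lemma conic_form_coords:
  "conic_form M P Q =
     P$1 * (M$1$1 * Q$1 + M$1$2 * Q$2 + M$1$3) + P$2 * (M$2$1 * Q$1 + M$2$2 * Q$2 + M$2$3) +
     (M$3$1 * Q$1 + M$3$2 * Q$2 + M$3$3)"
  by (simp add: conic_form_def hom_coords_def inner_vec_def matrix_vector_mult_def sum_3 vector_3)

lemma symmetric_entries:
  fixes M :: "real^3^3"
  assumes "transpose M = M" shows "M$2$1 = M$1$2" "M$3$1 = M$1$3" "M$3$2 = M$2$3"
proof -
  have "M$i$j = M$j$i" for i j
    by (subst assms[symmetric]) (simp add: transpose_def)
  then show "M$2$1 = M$1$2" "M$3$1 = M$1$3" "M$3$2 = M$2$3" by blast+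
qed

text \<open>Congruence by \<open>frame A B C\<close> turns \<open>M\<close> into the Gram matrix of
  the form at the three points and multiplies the determinant by the square of that of the
  frame.\<close>

lemma det_conic_form:
  assumes sym: "transpose M = M"
  shows "det M * (det (frame A B C))\<^sup>2 =
    conic_form M A A * conic_form M B B * conic_form M C C
    + 2 * conic_form M A B * conic_form M B C * conic_form M C A
    - conic_form M A A * (conic_form M B C)\<^sup>2 - conic_form M B B * (conic_form M C A)\<^sup>2
    - conic_form M C C * (conic_form M A B)\<^sup>2"
proof -
  define T where "T = frame A B C"
  have "det M * (det T)\<^sup>2 = det (transpose T ** M ** T)"
    by (simp add: det_mul power2_eq_square)
  also have "\<dots> = conic_form M A A * conic_form M B B * conic_form M C C
    + 2 * conic_form M A B * conic_form M B C * conic_form M C A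
    - conic_form M A A * (conic_form M B C)\<^sup>2 - conic_form M B B * (conic_form M C A)\<^sup>2
    - conic_form M C C * (conic_form M A B)\<^sup>2"
    unfolding det_3 entry_as_form congruence_form T_def frame_axis conic_form_def[symmetric]
      conic_form_sym[OF sym, of B A] conic_form_sym[OF sym, of C B] conic_form_sym[OF sym, of A C]
    by (simp add: power2_eq_square)
  finally show ?thesis by (simp add: T_def)
qed

text \<open>Differences of homogeneous coordinate vectors have last entry 0, so only the upper left
  2x2 block of \<open>M\<close> acts on them. The right side is the Gram determinant of that block
  on \<open>B - A\<close> and \<open>C - A\<close>, and the determinant of these two vectors is
  \<open>det (frame A B C)\<close>.\<close>

lemma discriminant_conic_form:
  assumes sym: "transpose M = M"
  shows "(M$1$1 * M$2$2 - (M$1$2)\<^sup>2) * (det (frame A B C))\<^sup>2 =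
    (conic_form M B B - 2 * conic_form M A B + conic_form M A A) *
    (conic_form M C C - 2 * conic_form M C A + conic_form M A A) -
    (conic_form M B C - conic_form M A B - conic_form M C A + conic_form M A A)\<^sup>2"
proof -
  define d1 d2 e1 e2 where
    d: "d1 = B$1 - A$1" "d2 = B$2 - A$2" "e1 = C$1 - A$1" "e2 = C$2 - A$2"
  note s = symmetric_entries[OF sym]
  have D: "det (frame A B C) = d1 * e2 - d2 * e1"
    unfolding frame_def det_transpose d
    by (simp add: det_3 hom_coords_def vector_3) (simp add: algebra_simps)
  have 1: "conic_form M B B - 2 * conic_form M A B + conic_form M A A =
      M$1$1 * d1\<^sup>2 + 2 * M$1$2 * d1 * d2 + M$2$2 * d2\<^sup>2"
    unfolding conic_form_coords s d by (simp add: power2_eq_square algebra_simps)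
  have 2: "conic_form M C C - 2 * conic_form M C A + conic_form M A A =
      M$1$1 * e1\<^sup>2 + 2 * M$1$2 * e1 * e2 + M$2$2 * e2\<^sup>2"
    unfolding conic_form_coords s d by (simp add: power2_eq_square algebra_simps)
  have 3: "conic_form M B C - conic_form M A B - conic_form M C A + conic_form M A A =
      M$1$1 * d1 * e1 + M$1$2 * (d1 * e2 + d2 * e1) + M$2$2 * d2 * e2"
    unfolding conic_form_coords s d by (simp add: power2_eq_square algebra_simps)
  show ?thesis unfolding D 1 2 3 by algebra
qed

section \<open>Recognising a parabola from its matrix\<close>

text \<open>The line has unit direction \<open>(n1, n2)\<close> and lies at signed offset
  \<open>s\<close> along the normal \<open>(- n2, n1)\<close>. It will serve as directrix.\<close>

lemma infdist_line:
  fixes n1 n2 s :: real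
  assumes n: "n1\<^sup>2 + n2\<^sup>2 = 1"
  defines "U \<equiv> vector [- n2 * s, n1 * s] :: real^2"
    and "V \<equiv> vector [- n2 * s + n1, n1 * s + n2] :: real^2"
  shows "P \<in> affine hull {U, V} \<longleftrightarrow> n1 * P$2 - n2 * P$1 = s"
    and "infdist P (affine hull {U, V}) = \<bar>n1 * P$2 - n2 * P$1 - s\<bar>"
proof -
  have mem: "Q \<in> affine hull {U, V} \<longleftrightarrow> n1 * Q$2 - n2 * Q$1 = s" for Q :: "real^2"
  proof
    assume "Q \<in> affine hull {U, V}"
    then obtain t where "Q = U + t *\<^sub>R (V - U)" by (auto simp: affine_hull_2_alt)
    then have "Q$1 = - n2 * s + t * n1" "Q$2 = n1 * s + t * n2"
      by (simp_all add: U_def V_def vector_2)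
    then show "n1 * Q$2 - n2 * Q$1 = s" using n by algebra
  next
    assume L: "n1 * Q$2 - n2 * Q$1 = s"
    have "Q$1 = - n2 * s + (n1 * Q$1 + n2 * Q$2) * n1"
      "Q$2 = n1 * s + (n1 * Q$1 + n2 * Q$2) * n2"
      using n L by algebra+
    then have "Q = U + (n1 * Q$1 + n2 * Q$2) *\<^sub>R (V - U)"
      by (simp add: U_def V_def vector_2 vec_eq_iff forall_2)
    then show "Q \<in> affine hull {U, V}" by (auto simp: affine_hull_2_alt)
  qed
  show "P \<in> affine hull {U, V} \<longleftrightarrow> n1 * P$2 - n2 * P$1 = s" by (rule mem)
  define r where "r = n1 * P$2 - n2 * P$1 - s"
  \<comment> \<open>\<open>H\<close> is the foot of the perpendicular from \<open>P\<close>, and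
    \<open>r\<close> is the signed distance.\<close>
  define H where "H = (vector [P$1 + n2 * r, P$2 - n1 * r] :: real^2)"
  have "n1 * (P$2 - n1 * r) - n2 * (P$1 + n2 * r) = s"
    using n unfolding r_def by algebra
  then have H: "H \<in> affine hull {U, V}" by (simp add: mem H_def vector_2)
  have "(n2 * r)\<^sup>2 + (n1 * r)\<^sup>2 = r\<^sup>2" using n by algebra
  then have PH: "dist P H = \<bar>r\<bar>"
    by (simp add: dist_vec_def L2_set_def sum_2 H_def vector_2 dist_real_def)
  show "infdist P (affine hull {U, V}) = \<bar>n1 * P$2 - n2 * P$1 - s\<bar>"
  proof (rule antisym)
    show "infdist P (affine hull {U, V}) \<le> \<bar>n1 * P$2 - n2 * P$1 - s\<bar>"
      using infdist_le[OF H, of P] PH by (simp add: r_def)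
    have "\<bar>r\<bar> \<le> dist P Q" if "Q \<in> affine hull {U, V}" for Q
    proof -
      define x y where "x = P$1 - Q$1" and "y = P$2 - Q$2"
      have "r = n1 * y - n2 * x"
        using that by (simp add: mem r_def x_def y_def algebra_simps)
      \<comment> \<open>Pythagoras for \<open>P - Q\<close>, split along the normal and the
        direction of the line; the tangential square is then dropped.\<close>
      then have "r\<^sup>2 + (n1 * x + n2 * y)\<^sup>2 = x\<^sup>2 + y\<^sup>2" using n by algebra
      then have "r\<^sup>2 \<le> x\<^sup>2 + y\<^sup>2" by (smt (verit) zero_le_power2)
      then have "sqrt (r\<^sup>2) \<le> sqrt (x\<^sup>2 + y\<^sup>2)" by (rule real_sqrt_le_mono)
      then show ?thesis
        by (simp add: dist_vec_def L2_set_def sum_2 dist_real_def x_def y_def)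
    qed
    moreover have "affine hull {U, V} \<noteq> {}" using H by auto
    ultimately show "\<bar>n1 * P$2 - n2 * P$1 - s\<bar> \<le> infdist P (affine hull {U, V})"
      unfolding r_def[symmetric] infdist_notempty[OF \<open>affine hull {U, V} \<noteq> {}\<close>]
      by (intro cINF_greatest) auto
  qed
qed

text \<open>Along the unit normal \<open>n\<close> of the axis the quadratic part is \<open>k(n \<bullet> P)\<^sup>2\<close>; the focus
  \<open>f n + (s - m/2) n\<^sup>\<bottom>\<close> and the directrix \<open>n\<^sup>\<bottom> \<bullet> P = s\<close> come from comparing coefficients with
  \<open>|P - F|\<^sup>2 = (n\<^sup>\<bottom> \<bullet> P - s)\<^sup>2\<close>.\<close>

lemma is_parabola_conic_points:
  assumes sym: "transpose M = M" and det: "det M \<noteq> 0"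
    and disc: "M$1$1 * M$2$2 = (M$1$2)\<^sup>2"
  shows "is_parabola (conic_points M)"
proof -
  define p q r l1 l2 h where
    e: "p = M$1$1" "q = M$1$2" "r = M$2$2" "l1 = M$1$3" "l2 = M$2$3" "h = M$3$3"
  note s = symmetric_entries[OF sym]
  have pr: "p * r = q\<^sup>2" using disc by (simp add: e)
  \<comment> \<open>The coefficient of \<open>h\<close> in the determinant is
    \<open>p * r - q\<^sup>2\<close>, which vanishes.\<close>
  have dM: "det M = 2 * q * l1 * l2 - p * l2\<^sup>2 - r * l1\<^sup>2"
    unfolding det_3 s e[symmetric] using pr by (simp add: power2_eq_square algebra_simps)
  \<comment> \<open>The quadratic part has determinant 0, so its trace \<open>k\<close> is its only
    possibly nonzero eigenvalue; \<open>n\<close> below is a unit eigenvector for it.\<close>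
  define k where "k = p + r"
  have k0: "k \<noteq> 0"
  proof
    assume "k = 0"
    then have r: "r = - p" by (simp add: k_def)
    with pr have "p\<^sup>2 + q\<^sup>2 = 0" by algebra
    then have "p = 0" "q = 0" by (simp_all add: sum_power2_eq_zero_iff)
    with r det dM show False by simp
  qed
  obtain n1 n2 where n: "n1\<^sup>2 + n2\<^sup>2 = 1"
    and pqr: "p = k * n1\<^sup>2" "q = k * (n1 * n2)" "r = k * n2\<^sup>2"
  proof (cases "p = 0")
    case True
    with pr have "q = 0" by simp
    with True show ?thesis by (intro that[of 0 1]) (simp_all add: k_def)
  next
    case False
    \<comment> \<open>The first row \<open>(p, q)\<close> of a symmetric rank one matrix spans its
      image, so normalising it gives \<open>n\<close>.\<close>
    define t where "t = sqrt (p\<^sup>2 + q\<^sup>2)"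
    have t2: "t\<^sup>2 = p\<^sup>2 + q\<^sup>2" by (simp add: t_def)
    have t0: "t\<^sup>2 \<noteq> 0" using False by (simp add: t2 sum_power2_eq_zero_iff)
    have kp: "k * p = t\<^sup>2" using pr unfolding k_def t2 by algebra
    show ?thesis
    proof (rule that[of "p / t" "q / t"])
      show "(p / t)\<^sup>2 + (q / t)\<^sup>2 = 1"
        using t0 by (simp add: power_divide t2 add_divide_distrib[symmetric])
      have "p * t\<^sup>2 = k * p\<^sup>2" unfolding kp[symmetric] by (simp add: power2_eq_square)
      then show "p = k * (p / t)\<^sup>2" using t0 by (simp add: power_divide field_simps)
      have "q * t\<^sup>2 = k * (p * q)" unfolding kp[symmetric] by simp
      then show "q = k * (p / t * (q / t))"
        using t0 by (simp add: power2_eq_square field_simps)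
      have "p * (r * t\<^sup>2) = p * (k * q\<^sup>2)" unfolding kp[symmetric] pr[symmetric] by simp
      then have "r * t\<^sup>2 = k * q\<^sup>2" using False by simp
      then show "r = k * (q / t)\<^sup>2" using t0 by (simp add: power_divide field_simps)
    qed
  qed
  \<comment> \<open>After division by \<open>k\<close>, the linear part has coefficient
    \<open>L\<close> along \<open>n\<close> and \<open>m\<close> along the normal
    \<open>(- n2, n1)\<close>.\<close>
  define L m where "L = 2 * (n1 * l1 + n2 * l2) / k" and "m = 2 * (n1 * l2 - n2 * l1) / k"
  have kL: "k * L = 2 * (n1 * l1 + n2 * l2)" and km: "k * m = 2 * (n1 * l2 - n2 * l1)"
    using k0 by (simp_all add: L_def m_def)
  have m0: "m \<noteq> 0"
  proof
    assume "m = 0"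
    then have "n1 * l2 - n2 * l1 = 0" using km by simp
    \<comment> \<open>Here \<open>det M\<close> equals
      \<open>- k * (n1 * l2 - n2 * l1)\<^sup>2\<close>.\<close>
    then have "det M = 0" unfolding dM pqr by algebra
    with det show False by simp
  qed
  \<comment> \<open>Solves the comparison of constant terms, which is linear in \<open>s\<close>
    with coefficient \<open>m\<close>.\<close>
  define s where "s = (L\<^sup>2 / 4 + m\<^sup>2 / 4 - h / k) / m"
  have sm: "k * (s * m) = k * L\<^sup>2 / 4 + k * m\<^sup>2 / 4 - h"
    using m0 k0 by (simp add: s_def field_simps)
  \<comment> \<open>The linear term along the normal forces \<open>2 * (s - f) = m\<close>;
    completing the square along \<open>n\<close> gives the other focus coordinate
    \<open>- L / 2\<close>.\<close>
  define f where "f = s - m / 2"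
  define F where "F = (vector [- L / 2 * n1 - f * n2, - L / 2 * n2 + f * n1] :: real^2)"
  define U V :: "real^2" where "U = vector [- n2 * s, n1 * s]"
    and "V = vector [- n2 * s + n1, n1 * s + n2]"
  note line = infdist_line[OF n, of _ s, folded U_def V_def]
  have "U \<noteq> V"
  proof
    assume "U = V"
    then have "U$1 = V$1" "U$2 = V$2" by simp_all
    then have "n1 = 0" "n2 = 0" by (simp_all add: U_def V_def vector_2)
    with n show False by simp
  qed
  moreover have "F \<notin> affine hull {U, V}"
  proof -
    have "n1 * F$2 - n2 * F$1 = f * (n1\<^sup>2 + n2\<^sup>2)"
      by (simp add: F_def vector_2 power2_eq_square algebra_simps)
    then show ?thesis using n m0 by (simp add: line f_def)
  qed
  moreover have "P \<in> conic_points M \<longleftrightarrow> dist P F = infdist P (affine hull {U, V})" for P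
  proof -
    define x y where "x = P$1" and "y = P$2"
    define S where "S = (x - F$1)\<^sup>2 + (y - F$2)\<^sup>2"
    have "conic_form M P P = p * x\<^sup>2 + 2 * q * x * y + r * y\<^sup>2 + 2 * l1 * x + 2 * l2 * y + h"
      unfolding conic_form_coords symmetric_entries[OF sym] e x_def y_def
      by (simp add: power2_eq_square algebra_simps)
    also have "\<dots> = k * (n1 * x + n2 * y)\<^sup>2 + k * L * (n1 * x + n2 * y)
        + k * m * (n1 * y - n2 * x) + h"
    proof -
      have "2 * l1 * x + 2 * l2 * y = k * L * (n1 * x + n2 * y) + k * m * (n1 * y - n2 * x)"
        unfolding kL km using n by algebra
      moreover have "p * x\<^sup>2 + 2 * q * x * y + r * y\<^sup>2 = k * (n1 * x + n2 * y)\<^sup>2"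
        unfolding pqr by algebra
      ultimately show ?thesis by simp
    qed
    also have "\<dots> = k * (S - (n1 * y - n2 * x - s)\<^sup>2)"
    proof -
      \<comment> \<open>Coordinates of \<open>P\<close> in the rotated orthonormal frame, where the
        focus is \<open>(- L / 2, f)\<close>.\<close>
      define N E where "N = n1 * x + n2 * y" and "E = n1 * y - n2 * x"
      have S: "S = (N + L / 2)\<^sup>2 + (E - f)\<^sup>2"
      proof -
        have xy: "x - F$1 = n1 * (N + L / 2) - n2 * (E - f)"
          "y - F$2 = n2 * (N + L / 2) + n1 * (E - f)"
          using n unfolding F_def vector_2 N_def E_def by algebra+
        have "(n1 * u - n2 * v)\<^sup>2 + (n2 * u + n1 * v)\<^sup>2 = (u\<^sup>2 + v\<^sup>2) * (n1\<^sup>2 + n2\<^sup>2)" for u v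
          by (simp add: power2_eq_square algebra_simps)
        then have "S = ((N + L / 2)\<^sup>2 + (E - f)\<^sup>2) * (n1\<^sup>2 + n2\<^sup>2)"
          unfolding S_def xy .
        with n show ?thesis by simp
      qed
      have "k * (S - (E - s)\<^sup>2) =
          k * N\<^sup>2 + k * L * N + k * m * E + (k * L\<^sup>2 / 4 + k * m\<^sup>2 / 4 - k * (s * m))"
        unfolding S f_def by (simp add: power2_eq_square field_simps)
      also have "k * L\<^sup>2 / 4 + k * m\<^sup>2 / 4 - k * (s * m) = h" using sm by simp
      finally show ?thesis by (simp add: N_def E_def)
    qed
    finally have "P \<in> conic_points M \<longleftrightarrow> S = (n1 * y - n2 * x - s)\<^sup>2"
      using k0 by (simp add: conic_points_def conic_form_def[symmetric])
    also have "\<dots> \<longleftrightarrow> sqrt S = sqrt ((n1 * y - n2 * x - s)\<^sup>2)" by (rule real_sqrt_eq_iff[symmetric])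
    also have "sqrt S = dist P F"
      by (simp add: S_def dist_vec_def L2_set_def sum_2 dist_real_def x_def y_def)
    also have "sqrt ((n1 * y - n2 * x - s)\<^sup>2) = infdist P (affine hull {U, V})"
      by (simp add: line x_def y_def)
    finally show ?thesis .
  qed
  ultimately show ?thesis unfolding is_parabola_def by blast
qed

section \<open>Values of the Yiu form at the triangle\<close>

text \<open>Makes explicit the factors that \<open>is_yiu_conic_iff\<close> leaves existential, by
  applying \<open>vertices_on_conic_iff\<close> to each side. If the value at \<open>A\<close> were
  0, all six values would vanish and force \<open>M = 0\<close>.\<close>

lemma yiu_conic_forms:
  assumes ne: "A \<noteq> B" and nc: "C \<notin> affine hull {A, B}" and Y: "is_yiu_conic A B C M"
  defines "k \<equiv> \<lambda>F1 F2 X. 1 + 2 * (dist F1 F2)\<^sup>2 /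
    ((dist X F1 + dist X F2)\<^sup>2 - (dist F1 F2)\<^sup>2)"
  shows "conic_form M B B = conic_form M A A" "conic_form M C C = conic_form M A A"
    "conic_form M B C = k B C A * conic_form M A A"
    "conic_form M C A = k C A B * conic_form M A A"
    "conic_form M A B = k A B C * conic_form M A A"
    "conic_form M A A \<noteq> 0"
proof -
  note p = noncollinear_perm[OF ne nc]
  have sym: "transpose M = M" and M0: "M \<noteq> 0"
    using Y by (simp_all add: is_yiu_conic_def is_conic_def)
  have sub: "v_ellipse_vertices B C A \<subseteq> conic_points M"
    "v_ellipse_vertices C A B \<subseteq> conic_points M" "v_ellipse_vertices A B C \<subseteq> conic_points M"
    using Y by (auto simp: is_yiu_conic_def six_vertices_def)
  note i = vertices_on_conic_iff[OF _ _ sym]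
  note f = sub(1)[unfolded i[OF p(1) foci_sum_gt[OF p(3)]]]
    sub(2)[unfolded i[OF p(2) foci_sum_gt[OF p(4)]]] sub(3)[unfolded i[OF ne foci_sum_gt[OF nc]]]
  show B: "conic_form M B B = conic_form M A A" and C: "conic_form M C C = conic_form M A A"
    using f by simp_all
  show 3: "conic_form M B C = k B C A * conic_form M A A"
    "conic_form M C A = k C A B * conic_form M A A"
    "conic_form M A B = k A B C * conic_form M A A"
    using f[unfolded B C] by (simp_all add: k_def)
  show "conic_form M A A \<noteq> 0"
  proof
    assume 0: "conic_form M A A = 0"
    have t0: "transpose (0 :: real^3^3) = 0" by (simp add: transpose_def vec_eq_iff)
    have z: "conic_form 0 P Q = 0" for P Q by (simp add: conic_form_def)
    have "M = 0"
      by (rule matrix_eqI_on_frame[OF ne nc sym t0])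
        (simp_all only: B C 3 z 0 mult_zero_right)
    with M0 show False ..
  qed
qed

section \<open>Right angles and degeneracy\<close>

lemma dist_sq_coords:
  "(dist P Q)\<^sup>2 = (P$1 - Q$1)\<^sup>2 + (P$2 - Q$2)\<^sup>2" for P Q :: "real^2"
  by (simp add: dist_vec_def L2_set_def sum_2 dist_real_def)

text \<open>Thales gives a right angle at \<open>C\<close> on the circle; a tangent is perpendicular
  to the diameter, giving one at \<open>A\<close> or \<open>B\<close>.\<close>

lemma right_angle:
  assumes "C \<in> diameter_circle A B \<union> circle_tangent (midpoint A B) A
    \<union> circle_tangent (midpoint A B) B"
  shows "(dist A B)\<^sup>2 = (dist B C)\<^sup>2 + (dist C A)\<^sup>2 \<or> (dist B C)\<^sup>2 = (dist C A)\<^sup>2 + (dist A B)\<^sup>2 \<or>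
    (dist C A)\<^sup>2 = (dist A B)\<^sup>2 + (dist B C)\<^sup>2"
  using assms
proof (elim UnE)
  have mp: "midpoint A B $ i = (A$i + B$i) / 2" for i by (simp add: midpoint_def)
  {
    assume "C \<in> diameter_circle A B"
    then have "dist (midpoint A B) C = dist A B / 2" by (simp add: diameter_circle_def)
    then have "(dist (midpoint A B) C)\<^sup>2 = (dist A B)\<^sup>2 / 4"
      by (simp only: power_divide) simp
    then have "(dist A B)\<^sup>2 = (dist B C)\<^sup>2 + (dist C A)\<^sup>2"
      unfolding dist_sq_coords mp by (simp add: power2_eq_square field_simps)
    then show ?thesis by blast
  next
    assume "C \<in> circle_tangent (midpoint A B) A"
    then have "(dist B C)\<^sup>2 = (dist C A)\<^sup>2 + (dist A B)\<^sup>2"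
      unfolding dist_sq_coords
      by (simp add: circle_tangent_def inner_vec_def sum_2 mp power2_eq_square field_simps)
    then show ?thesis by blast
  next
    assume "C \<in> circle_tangent (midpoint A B) B"
    then have "(dist C A)\<^sup>2 = (dist A B)\<^sup>2 + (dist B C)\<^sup>2"
      unfolding dist_sq_coords
      by (simp add: circle_tangent_def inner_vec_def sum_2 mp power2_eq_square field_simps)
    then show ?thesis by blast
  }
qed

text \<open>With hypotenuse \<open>c\<close> the entries reduce to \<open>u = c / b\<close>,
  \<open>v = c / a\<close>, \<open>w = 1 + u * v\<close>. The determinant becomes
  \<open>(u * v)\<^sup>2 - u\<^sup>2 - v\<^sup>2\<close>, which is 0 by Pythagoras.\<close>

lemma gram_det_right_angle:
  fixes a b c :: real
  assumes pos: "a > 0" "b > 0" "c > 0" and right: "c\<^sup>2 = a\<^sup>2 + b\<^sup>2"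
  defines "u \<equiv> 1 + 2 * a\<^sup>2 / ((b + c)\<^sup>2 - a\<^sup>2)" and "v \<equiv> 1 + 2 * b\<^sup>2 / ((c + a)\<^sup>2 - b\<^sup>2)"
    and "w \<equiv> 1 + 2 * c\<^sup>2 / ((a + b)\<^sup>2 - c\<^sup>2)"
  shows "1 + 2 * u * v * w - u\<^sup>2 - v\<^sup>2 - w\<^sup>2 = 0"
proof -
  have "b + c \<noteq> 0" "c + a \<noteq> 0" using pos by simp_all
  moreover have "(b + c)\<^sup>2 - a\<^sup>2 = 2 * b * (b + c)" "(c + a)\<^sup>2 - b\<^sup>2 = 2 * a * (c + a)"
    "(a + b)\<^sup>2 - c\<^sup>2 = 2 * a * b"
    using right by algebra+
  moreover have "b * (b + c) + a\<^sup>2 = c * (b + c)" "a * (c + a) + b\<^sup>2 = c * (c + a)"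
    using right by algebra+
  ultimately have uv: "u = c / b" "v = c / a" and w: "w = 1 + u * v"
    unfolding u_def v_def w_def using pos by (simp_all add: divide_simps power2_eq_square)
  have "(u * v)\<^sup>2 = c\<^sup>2 * c\<^sup>2 / (a\<^sup>2 * b\<^sup>2)"
    by (simp add: uv power_mult_distrib power_divide power2_eq_square mult_ac)
  also have "\<dots> = c\<^sup>2 * a\<^sup>2 / (a\<^sup>2 * b\<^sup>2) + c\<^sup>2 * b\<^sup>2 / (a\<^sup>2 * b\<^sup>2)"
    by (subst (2) right) (simp add: distrib_left add_divide_distrib)
  also have "\<dots> = u\<^sup>2 + v\<^sup>2" using pos by (simp add: uv power_divide)
  finally show ?thesis unfolding w by algebra
qed

section \<open>The octic as a discriminant\<close>

lemma octic_imp_discriminant_zero: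
  fixes a b c U V W :: real
  assumes E: "a^8 + b^8 + c^8 - 2 * (a^4 * b^4 + a^4 * c^4 + b^4 * c^4)
      + 4 * a * b * c *
        (a^5 + b^5 + c^5 - a^4 * b - a * b^4 - a^4 * c - a * c^4 - b * c^4 - b^4 * c
         + a^3 * b * c + a * b^3 * c + a * b * c^3) = 0"
    and nz: "(b + c)\<^sup>2 - a\<^sup>2 \<noteq> 0" "(c + a)\<^sup>2 - b\<^sup>2 \<noteq> 0" "(a + b)\<^sup>2 - c\<^sup>2 \<noteq> 0"
    and U: "U = 2 * a\<^sup>2 / ((b + c)\<^sup>2 - a\<^sup>2)"
    and V: "V = 2 * b\<^sup>2 / ((c + a)\<^sup>2 - b\<^sup>2)"
    and W: "W = 2 * c\<^sup>2 / ((a + b)\<^sup>2 - c\<^sup>2)"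
  shows "2 * (U * V + V * W + W * U) - U\<^sup>2 - V\<^sup>2 - W\<^sup>2 = 0"
proof -
  \<comment> \<open>The factors from Heron's formula: each denominator is \<open>p\<close> times one
    of \<open>x\<close>, \<open>y\<close>, \<open>z\<close>.\<close>
  define x y z p where xyz: "x = b + c - a" "y = c + a - b" "z = a + b - c" "p = a + b + c"
  have fac: "(b + c)\<^sup>2 - a\<^sup>2 = p * x" "(c + a)\<^sup>2 - b\<^sup>2 = p * y" "(a + b)\<^sup>2 - c\<^sup>2 = p * z"
    unfolding xyz by algebra+
  have nz': "p \<noteq> 0" "x \<noteq> 0" "y \<noteq> 0" "z \<noteq> 0" using nz unfolding fac by auto
  have 1: "p * x * U = 2 * a\<^sup>2" "p * y * V = 2 * b\<^sup>2" "p * z * W = 2 * c\<^sup>2"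
    unfolding U V W fac using nz' by simp_all
  \<comment> \<open>Multiplying by \<open>(p * x * y * z)\<^sup>2\<close> lets \<open>U\<close>,
    \<open>V\<close>, \<open>W\<close> occur only in products whose values are known, so no
    fractions remain; the result is -4 times the octic.\<close>
  have "(2 * (U * V + V * W + W * U) - U\<^sup>2 - V\<^sup>2 - W\<^sup>2) * (p * x * y * z)\<^sup>2 =
      2 * ((p * x * U) * (p * y * V) * (x * y * z\<^sup>2) + (p * y * V) * (p * z * W) * (y * z * x\<^sup>2)
        + (p * z * W) * (p * x * U) * (z * x * y\<^sup>2))
      - (p * x * U)\<^sup>2 * (y * z)\<^sup>2 - (p * y * V)\<^sup>2 * (z * x)\<^sup>2 - (p * z * W)\<^sup>2 * (x * y)\<^sup>2"
    by algebra
  also have "\<dots> = - 4 * (a^8 + b^8 + c^8 - 2 * (a^4 * b^4 + a^4 * c^4 + b^4 * c^4)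
      + 4 * a * b * c *
        (a^5 + b^5 + c^5 - a^4 * b - a * b^4 - a^4 * c - a * c^4 - b * c^4 - b^4 * c
         + a^3 * b * c + a * b^3 * c + a * b * c^3))"
    unfolding 1 unfolding xyz by algebra
  finally have "(2 * (U * V + V * W + W * U) - U\<^sup>2 - V\<^sup>2 - W\<^sup>2) * (p * x * y * z)\<^sup>2 = 0"
    unfolding E by simp
  then show ?thesis using nz' by (simp only: mult_eq_0_iff power_eq_0_iff) simp
qed

section \<open>Degeneracy and parabolicity of the Yiu conic\<close>

theorem proposition7:
  fixes A B C :: "real^2" and Y :: "real^3^3" and a b c :: real
  assumes "A \<noteq> B"
    and "C \<notin> affine hull {A, B}"
    and "a = dist B C" and "b = dist C A" and "c = dist A B"
    and "is_yiu_conic A B C Y"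
  shows "(C \<in> diameter_circle A B \<union> circle_tangent (midpoint A B) A
              \<union> circle_tangent (midpoint A B) B
            \<longrightarrow> degenerate_conic Y) \<and>
         (a^8 + b^8 + c^8 - 2 * (a^4 * b^4 + a^4 * c^4 + b^4 * c^4)
            + 4 * a * b * c *
              (a^5 + b^5 + c^5 - a^4 * b - a * b^4 - a^4 * c - a * c^4 - b * c^4 - b^4 * c
               + a^3 * b * c + a * b^3 * c + a * b * c^3) = 0
            \<longrightarrow> is_parabola (conic_points Y))"
proof -
  note ne = assms(1) and nc = assms(2)
  note p = noncollinear_perm[OF ne nc]
  have sym: "transpose Y = Y" using assms(6) by (simp add: is_yiu_conic_def is_conic_def)
  have pos: "a > 0" "b > 0" "c > 0" using assms(3-5) p(1,2) ne by simp_all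
  have tri: "a < b + c" "b < c + a" "c < a + b"
    using foci_sum_gt[OF p(3)] foci_sum_gt[OF p(4)] foci_sum_gt[OF nc] assms(3-5)
    by (simp_all add: dist_commute)
  have den: "(b + c)\<^sup>2 - a\<^sup>2 \<noteq> 0" "(c + a)\<^sup>2 - b\<^sup>2 \<noteq> 0" "(a + b)\<^sup>2 - c\<^sup>2 \<noteq> 0"
    using tri pos by (simp_all add: power2_eq_iff)
  define g where "g = conic_form Y A A"
  define U V W where U: "U = 2 * a\<^sup>2 / ((b + c)\<^sup>2 - a\<^sup>2)"
    and V: "V = 2 * b\<^sup>2 / ((c + a)\<^sup>2 - b\<^sup>2)" and W: "W = 2 * c\<^sup>2 / ((a + b)\<^sup>2 - c\<^sup>2)"
  have d: "dist B C = a" "dist C A = b" "dist A B = c" "dist C B = a" "dist A C = b" "dist B A = c"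
    using assms(3-5) by (simp_all add: dist_commute)
  have forms: "conic_form Y A A = g" "conic_form Y B B = g" "conic_form Y C C = g"
    "conic_form Y B C = (1 + U) * g" "conic_form Y C A = (1 + V) * g"
    "conic_form Y A B = (1 + W) * g" and g0: "g \<noteq> 0"
    using yiu_conic_forms[OF ne nc assms(6)]
    by (simp_all add: d U V W g_def add.commute)
  have D0: "det (frame A B C) \<noteq> 0"
    using invertible_frame[OF ne nc] by (simp add: invertible_det_nz)
  have det: "det Y * (det (frame A B C))\<^sup>2 =
      g^3 * (1 + 2 * (1 + U) * (1 + V) * (1 + W) - (1 + U)\<^sup>2 - (1 + V)\<^sup>2 - (1 + W)\<^sup>2)"
    unfolding det_conic_form[OF sym] forms by algebra
  show ?thesis
  proof (intro conjI impI)
    assume "C \<in> diameter_circle A B \<union> circle_tangent (midpoint A B) A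
              \<union> circle_tangent (midpoint A B) B"
    then have "c\<^sup>2 = a\<^sup>2 + b\<^sup>2 \<or> a\<^sup>2 = b\<^sup>2 + c\<^sup>2 \<or> b\<^sup>2 = c\<^sup>2 + a\<^sup>2"
      by (drule_tac right_angle) (simp add: d)
    then have "1 + 2 * (1 + U) * (1 + V) * (1 + W) - (1 + U)\<^sup>2 - (1 + V)\<^sup>2 - (1 + W)\<^sup>2 = 0"
      \<comment> \<open>The three cyclic rotations put the hypotenuse at \<open>c\<close>,
        \<open>a\<close> and \<open>b\<close> in turn.\<close>
      using gram_det_right_angle[OF pos(1,2,3)] gram_det_right_angle[OF pos(2,3,1)]
        gram_det_right_angle[OF pos(3,1,2)]
      unfolding U[symmetric] V[symmetric] W[symmetric] by (auto simp: algebra_simps)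
    then show "degenerate_conic Y" using det D0 by (simp add: degenerate_conic_def)
  next
    assume "a^8 + b^8 + c^8 - 2 * (a^4 * b^4 + a^4 * c^4 + b^4 * c^4)
            + 4 * a * b * c *
              (a^5 + b^5 + c^5 - a^4 * b - a * b^4 - a^4 * c - a * c^4 - b * c^4 - b^4 * c
               + a^3 * b * c + a * b^3 * c + a * b * c^3) = 0"
    from octic_imp_discriminant_zero[OF this den U V W]
    have 0: "2 * (U * V + V * W + W * U) - U\<^sup>2 - V\<^sup>2 - W\<^sup>2 = 0" .
    \<comment> \<open>On the edge vectors from \<open>A\<close> the Gram entries are
      \<open>- 2 * W * g\<close>, \<open>- 2 * V * g\<close> and, off the diagonal,
      \<open>(U - V - W) * g\<close>.\<close>
    have "(Y$1$1 * Y$2$2 - (Y$1$2)\<^sup>2) * (det (frame A B C))\<^sup>2 =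
        g\<^sup>2 * (2 * (U * V + V * W + W * U) - U\<^sup>2 - V\<^sup>2 - W\<^sup>2)"
      unfolding discriminant_conic_form[OF sym] forms by algebra
    with 0 D0 have disc: "Y$1$1 * Y$2$2 = (Y$1$2)\<^sup>2" by simp
    have "1 + 2 * (1 + U) * (1 + V) * (1 + W) - (1 + U)\<^sup>2 - (1 + V)\<^sup>2 - (1 + W)\<^sup>2 = 2 * U * V * W"
      using 0 by algebra
    moreover have "U \<noteq> 0" "V \<noteq> 0" "W \<noteq> 0" using den pos by (simp_all add: U V W)
    ultimately have "det Y \<noteq> 0" using det g0 by auto
    from is_parabola_conic_points[OF sym this disc] show "is_parabola (conic_points Y)" .
  qed
qed

end
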